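(* Let $\mathfrak{gl}_2=\langle e,f,h,g\mid [h,e]=2e,\ [h,f]=-2f,\ [e,f]=h\rangle$, a Lie ring additively isomorphic to $\mathbb{Z}^4$ (so $g$ is central), and let $\mathfrak{sl}_2=\langle e,f,h\mid [h,e]=2e,\ [h,f]=-2f,\ [e,f]=h\rangle$. Then for every prime $p>2$, $$\zeta_{\mathfrak{gl}_2(\mathbb{F}_p)}^{\leq}(s)=\zeta_{\mathfrak{sl}_2(\mathbb{F}_p)}^{\leq}(s)+t+(p+p^2)t^2+(p+p^2+p^3)t^3+t^4$$ $$=1+(2+p)t+(1+2p+2p^2)t^2+(1+p+p^2+p^3)t^3+t^4.$$
   Context: A presentation of a Lie ring lists a $\mathbb{Z}$-module basis together with brackets of basis elements; all brackets not listed are zero, up to antisymmetry. For a Lie ring $L\cong\mathbb{Z}^n$ (additively) and a prime $p$, $L(\mathbb{F}_p)=L\otimes_{\mathbb{Z}}\mathbb{F}_p$, and $\zeta_{L(\mathbb{F}_p)}^{\leq}(s)=\sum_{i=0}^{n}a_{p^i}^{\leq}(L(\mathbb{F}_p))\,t^{i}$, where $t=p^{-s}$ and $a_{p^i}^{\leq}(L(\mathbb{F}_p))$ is the number of $\mathbb{F}_p$-Lie subalgebras of $L(\mathbb{F}_p)$ of codimension $i$. *)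

theory Defs
  imports "HOL-Analysis.Analysis" "Berlekamp_Zassenhaus.Finite_Field"
begin

section \<open>Lie brackets on free modules of finite rank\<close>

definition lie_bracket :: "('a::comm_ring_1 ^ 'b::finite \<Rightarrow> 'a ^ 'b \<Rightarrow> 'a ^ 'b) \<Rightarrow> bool" where
  "lie_bracket L \<longleftrightarrow>
     (\<forall>x y z. L (x + y) z = L x z + L y z) \<and> (\<forall>c x y. L (c *s x) y = c *s L x y) \<and>
     (\<forall>x y z. L x (y + z) = L x y + L x z) \<and> (\<forall>c x y. L x (c *s y) = c *s L x y) \<and>
     (\<forall>x. L x x = 0) \<and>
     (\<forall>x y z. L x (L y z) + L y (L z x) + L z (L x y) = 0)"

text \<open>A presentation of a Lie ring on \<open>\<int>\<^sup>b\<close>: the list of the brackets of basis elements,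
  \<open>((i, j), v)\<close> standing for \<open>[i, j] = v\<close>. Unlisted brackets are zero, up to antisymmetry.\<close>

type_synonym 'b lie_presentation = "(('b \<times> 'b) \<times> (int ^ 'b)) list"

definition basis_bracket :: "'b::finite lie_presentation \<Rightarrow> 'b \<Rightarrow> 'b \<Rightarrow> int ^ 'b" where
  "basis_bracket P i j =
     (case map_of P (i, j) of Some v \<Rightarrow> v
      | None \<Rightarrow> (case map_of P (j, i) of Some v \<Rightarrow> - v | None \<Rightarrow> 0))"

definition presented_lie_ring ::
    "'b::finite lie_presentation \<Rightarrow> int ^ 'b \<Rightarrow> int ^ 'b \<Rightarrow> int ^ 'b" where
  "presented_lie_ring P x y = (\<Sum>i\<in>UNIV. \<Sum>j\<in>UNIV. (x $ i * y $ j) *s basis_bracket P i j)"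

section \<open>Base change\<close>

text \<open>\<open>\<int>\<^sup>b \<otimes> R\<close> is realised as \<open>R\<^sup>b\<close>, with \<open>x \<otimes> a\<close> corresponding to \<open>a *s of_int_vec x\<close>
  (see \<open>base_change_universal\<close>) and \<open>[x \<otimes> a, y \<otimes> b] = [x, y] \<otimes> a b\<close>
  (see \<open>base_change_tensors\<close>).\<close>

definition of_int_vec :: "int ^ 'b \<Rightarrow> 'a::ring_1 ^ 'b" where
  "of_int_vec x = (\<chi> i. of_int (x $ i))"

definition base_change ::
    "(int ^ 'b \<Rightarrow> int ^ 'b \<Rightarrow> int ^ 'b) \<Rightarrow> 'a::comm_ring_1 ^ 'b::finite \<Rightarrow> 'a ^ 'b \<Rightarrow> 'a ^ 'b" where
  "base_change L x y =
     (\<Sum>i\<in>UNIV. \<Sum>j\<in>UNIV. (x $ i * y $ j) *s of_int_vec (L (axis i 1) (axis j 1)))"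

lemma of_int_vec_simps:
  "of_int_vec 0 = (0 :: 'a::ring_1 ^ 'b)"
  "of_int_vec (x + y) = (of_int_vec x + of_int_vec y :: 'a ^ 'b)"
  "of_int_vec (c *s x) = (of_int c *s of_int_vec x :: 'a ^ 'b)"
  "of_int_vec (axis i 1) = (axis i 1 :: 'a ^ 'b)"
  by (auto simp: of_int_vec_def vec_eq_iff axis_def)

lemma of_int_vec_sum: "of_int_vec (sum f S) = (\<Sum>i\<in>S. of_int_vec (f i) :: 'a::ring_1 ^ 'b)"
  by (induction S rule: infinite_finite_induct) (auto simp: of_int_vec_simps)

lemma base_change_universal:
  fixes \<beta> :: "int ^ 'b::finite \<Rightarrow> 'a::comm_ring_1 \<Rightarrow> 'm::ab_group_add"
  assumes add1: "\<And>x y a. \<beta> (x + y) a = \<beta> x a + \<beta> y a"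
    and add2: "\<And>x a b. \<beta> x (a + b) = \<beta> x a + \<beta> x b"
  shows "\<exists>!\<phi>. (\<forall>v w. \<phi> (v + w) = \<phi> v + \<phi> w) \<and> (\<forall>x a. \<phi> (a *s of_int_vec x) = \<beta> x a)"
proof
  interpret l: additive "\<lambda>x. \<beta> x a" for a by unfold_locales (rule add1)
  interpret r: additive "\<beta> x" for x by unfold_locales (rule add2)
  have nat: "\<beta> x (a * of_nat n) = \<beta> (of_nat n *s x) a" for x a n
    by (induction n) (auto simp: algebra_simps add1 add2 r.zero l.zero vector_sadd_rdistrib)
  have int: "\<beta> x (a * of_int n) = \<beta> (n *s x) a" for x a n
  proof (cases n rule: int_cases2)
    case (nonneg m)
    then show ?thesis using nat[of x a m] by simp
  next
    case (nonpos m)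
    have "- int m *s x = - (int m *s x)" by (simp add: vec_eq_iff)
    with nonpos show ?thesis using nat[of x a m] by (simp add: r.minus l.minus)
  qed
  let ?\<phi> = "\<lambda>v. \<Sum>i\<in>UNIV. \<beta> (axis i 1) (v $ i)"
  have "?\<phi> (a *s of_int_vec x) = \<beta> x a" for x a
  proof -
    have "?\<phi> (a *s of_int_vec x) = (\<Sum>i\<in>UNIV. \<beta> (x $ i *s axis i 1) a)"
      by (simp add: of_int_vec_def int)
    also have "\<dots> = \<beta> (\<Sum>i\<in>UNIV. x $ i *s axis i 1) a"
      by (simp add: l.sum)
    finally show ?thesis by (simp add: basis_expansion)
  qed
  then show "(\<forall>v w. ?\<phi> (v + w) = ?\<phi> v + ?\<phi> w) \<and> (\<forall>x a. ?\<phi> (a *s of_int_vec x) = \<beta> x a)"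
    by (auto simp: add2 sum.distrib)
  fix \<phi> :: "'a ^ 'b \<Rightarrow> 'm"
  assume \<phi>: "(\<forall>v w. \<phi> (v + w) = \<phi> v + \<phi> w) \<and> (\<forall>x a. \<phi> (a *s of_int_vec x) = \<beta> x a)"
  interpret p: additive \<phi> by unfold_locales (use \<phi> in auto)
  show "\<phi> = ?\<phi>"
  proof
    fix v
    have "\<phi> v = \<phi> (\<Sum>i\<in>UNIV. v $ i *s of_int_vec (axis i 1))"
      by (simp add: of_int_vec_simps basis_expansion)
    also have "\<dots> = ?\<phi> v" using \<phi> by (simp add: p.sum)
    finally show "\<phi> v = ?\<phi> v" .
  qed
qed

lemma base_change_tensors:
  fixes L :: "int ^ 'b::finite \<Rightarrow> int ^ 'b \<Rightarrow> int ^ 'b"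
    and a b :: "'a::comm_ring_1" and x y :: "int ^ 'b"
  assumes "lie_bracket L"
  shows "base_change L (a *s of_int_vec x) (b *s of_int_vec y) = (a * b) *s of_int_vec (L x y)"
proof -
  interpret l: additive "\<lambda>u. L u v" for v
    by unfold_locales (use assms in \<open>auto simp: lie_bracket_def\<close>)
  interpret r: additive "L u" for u
    by unfold_locales (use assms in \<open>auto simp: lie_bracket_def\<close>)
  have scale: "L (c *s u) v = c *s L u v" "L u (c *s v) = c *s L u v" for c u v
    using assms by (auto simp: lie_bracket_def)
  have "L x y = L (\<Sum>i\<in>UNIV. x $ i *s axis i 1) (\<Sum>j\<in>UNIV. y $ j *s axis j 1)"
    by (simp add: basis_expansion)
  also have "\<dots> = (\<Sum>i\<in>UNIV. \<Sum>j\<in>UNIV. (x $ i * y $ j) *s L (axis i 1) (axis j 1))"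
    unfolding l.sum by (simp add: r.sum scale vec_eq_iff sum_distrib_left mult_ac)
  finally have Lxy: "L x y = (\<Sum>i\<in>UNIV. \<Sum>j\<in>UNIV. (x $ i * y $ j) *s L (axis i 1) (axis j 1))" .
  have "(of_int_vec (L x y) :: 'a ^ 'b) =
      (\<Sum>i\<in>UNIV. \<Sum>j\<in>UNIV. of_int (x $ i * y $ j) *s of_int_vec (L (axis i 1) (axis j 1)))"
    by (subst Lxy) (simp add: of_int_vec_sum of_int_vec_simps)
  then show ?thesis
    by (simp add: base_change_def vec_eq_iff sum_distrib_left of_int_vec_def mult_ac)
qed

section \<open>The Lie rings $\mathfrak{gl}_2$ and $\mathfrak{sl}_2$\<close>

datatype gl2_basis = Ge | Gf | Gh | Gg

datatype sl2_basis = Se | Sf | Sh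

lemma UNIV_gl2_basis: "UNIV = {Ge, Gf, Gh, Gg}"
  by (auto intro: gl2_basis.exhaust)

lemma UNIV_sl2_basis: "UNIV = {Se, Sf, Sh}"
  by (auto intro: sl2_basis.exhaust)

instance gl2_basis :: finite
  by standard (simp add: UNIV_gl2_basis)

instance sl2_basis :: finite
  by standard (simp add: UNIV_sl2_basis)

definition gl2 :: "int ^ gl2_basis \<Rightarrow> int ^ gl2_basis \<Rightarrow> int ^ gl2_basis" where
  "gl2 = presented_lie_ring
     [((Gh, Ge), 2 *s axis Ge 1), ((Gh, Gf), (-2) *s axis Gf 1), ((Ge, Gf), axis Gh 1)]"

definition sl2 :: "int ^ sl2_basis \<Rightarrow> int ^ sl2_basis \<Rightarrow> int ^ sl2_basis" where
  "sl2 = presented_lie_ring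
     [((Sh, Se), 2 *s axis Se 1), ((Sh, Sf), (-2) *s axis Sf 1), ((Se, Sf), axis Sh 1)]"

lemma all_gl2_basis: "(\<forall>i. P i) \<longleftrightarrow> P Ge \<and> P Gf \<and> P Gh \<and> P Gg"
  by (metis gl2_basis.exhaust)

lemma all_sl2_basis: "(\<forall>i. P i) \<longleftrightarrow> P Se \<and> P Sf \<and> P Sh"
  by (metis sl2_basis.exhaust)

lemma gl2_nth:
  "gl2 x y $ Ge = 2 * (x $ Gh * y $ Ge - x $ Ge * y $ Gh)"
  "gl2 x y $ Gf = 2 * (x $ Gf * y $ Gh - x $ Gh * y $ Gf)"
  "gl2 x y $ Gh = x $ Ge * y $ Gf - x $ Gf * y $ Ge"
  "gl2 x y $ Gg = 0"
  by (simp_all add: gl2_def presented_lie_ring_def basis_bracket_def UNIV_gl2_basis axis_def)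

lemma sl2_nth:
  "sl2 x y $ Se = 2 * (x $ Sh * y $ Se - x $ Se * y $ Sh)"
  "sl2 x y $ Sf = 2 * (x $ Sf * y $ Sh - x $ Sh * y $ Sf)"
  "sl2 x y $ Sh = x $ Se * y $ Sf - x $ Sf * y $ Se"
  by (simp_all add: sl2_def presented_lie_ring_def basis_bracket_def UNIV_sl2_basis axis_def)

lemma lie_bracket_gl2: "lie_bracket gl2"
  by (simp add: lie_bracket_def vec_eq_iff all_gl2_basis gl2_nth algebra_simps)

lemma lie_bracket_sl2: "lie_bracket sl2"
  by (simp add: lie_bracket_def vec_eq_iff all_sl2_basis sl2_nth algebra_simps)

section \<open>Subalgebra zeta functions over prime fields\<close>

definition lie_subalgebra ::
    "('k::field ^ 'b::finite \<Rightarrow> 'k ^ 'b \<Rightarrow> 'k ^ 'b) \<Rightarrow> ('k ^ 'b) set \<Rightarrow> bool" where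
  "lie_subalgebra L S \<longleftrightarrow> vec.subspace S \<and> (\<forall>x\<in>S. \<forall>y\<in>S. L x y \<in> S)"

definition num_subalgebras ::
    "('k::field ^ 'b::finite \<Rightarrow> 'k ^ 'b \<Rightarrow> 'k ^ 'b) \<Rightarrow> nat \<Rightarrow> nat" where
  "num_subalgebras L i = card {S. lie_subalgebra L S \<and> vec.dim S + i = CARD('b)}"

text \<open>\<open>zeta_Fp TYPE('p) L\<close> is the subalgebra zeta function of \<open>L \<otimes> \<int>/p\<int>\<close>, where \<open>p = CARD('p)\<close> and
  \<open>'p mod_ring\<close> is the field of integers modulo \<open>p\<close>.\<close>

definition zeta_Fp ::
    "'p::prime_card itself \<Rightarrow> (int ^ 'b::finite \<Rightarrow> int ^ 'b \<Rightarrow> int ^ 'b) \<Rightarrow> complex \<Rightarrow> complex" where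
  "zeta_Fp _ L s =
     (\<Sum>i\<le>CARD('b). of_nat (num_subalgebras (base_change L :: 'p mod_ring ^ 'b \<Rightarrow> _) i) *
        (of_nat CARD('p) powr (- s) :: complex) ^ i)"

end

theory Submission
  imports Defs
begin

text \<open>Write \<open>q\<close> for the order of the field; a subspace of dimension \<open>k\<close> has \<open>q\<^sup>k\<close> elements, so
  dimensions are read off from cardinalities. Every line is a subalgebra, and a plane in \<open>sl2\<close> is
  a subalgebra iff its normal vector lies on a nondegenerate conic, which has \<open>q + 1\<close> points. Since
  \<open>gl2\<close> is \<open>sl2\<close> plus a central line, a subalgebra of \<open>gl2\<close> either contains this line, and is then
  the preimage of a subalgebra of \<open>sl2\<close>, or is the graph of a character of a subalgebra \<open>M\<close> of
  \<open>sl2\<close>. The characters of \<open>M\<close> are the functionals on \<open>M / [M, M]\<close>: there are \<open>q\<close> of them if \<open>M\<close> is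
  a plane, and only the zero one if \<open>M = sl2\<close>.\<close>

section \<open>Counting subspaces over a finite field\<close>

text \<open>Adjoining a vector \<open>b\<close> outside \<open>vec.span B\<close> multiplies the
  size of the span by q, because every element of the new span is \<open>k *s b + s\<close> for
  exactly one pair. Induction along a basis then gives the power of q.\<close>

lemma card_subspace:
  fixes S :: "('a::{field,finite} ^ 'b::finite) set"
  assumes "vec.subspace S"
  shows "card S = CARD('a) ^ vec.dim S"
proof -
  have ind: "finite B \<Longrightarrow> vec.independent B \<Longrightarrow> card (vec.span B) = CARD('a) ^ card B"
    for B :: "('a ^ 'b) set"
  proof (induction B rule: finite_induct)
    case (insert b B)
    then have b: "b \<notin> vec.span B" and B: "vec.independent B"
      by (auto simp: vec.independent_insert)
    have "bij_betw (\<lambda>(k, s). k *s b + s) (UNIV \<times> vec.span B) (vec.span (insert b B))"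
    proof (rule bij_betw_imageI)
      show "inj_on (\<lambda>(k, s). k *s b + s) (UNIV \<times> vec.span B)"
      proof (rule inj_onI, clarify)
        fix k l s r
        assume *: "k *s b + s = l *s b + r" "s \<in> vec.span B" "r \<in> vec.span B"
        then have "(k - l) *s b = r - s"
          by (simp add: vector_sub_rdistrib algebra_simps)
        then have "(k - l) *s b \<in> vec.span B"
          using * by (simp add: vec.span_diff)
        \<comment> \<open>If \<open>k\<close> and \<open>l\<close> differed, dividing by
          \<open>k - l\<close> would put \<open>b\<close> into \<open>vec.span B\<close>.\<close>
        from vec.span_scale[OF this, of "inverse (k - l)"] b have "k = l"
          by (cases "k = l") (simp_all del: vector_sub_rdistrib add: vector_smult_assoc)
        with * show "k = l \<and> s = r" by simp
      qed
      show "(\<lambda>(k, s). k *s b + s) ` (UNIV \<times> vec.span B) = vec.span (insert b B)"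
      proof -
        have "y \<in> (\<lambda>(k, s). k *s b + s) ` (UNIV \<times> vec.span B)" if "y - k *s b \<in> vec.span B" for k y
          by (rule image_eqI[of _ _ "(k, y - k *s b)"]) (use that in auto)
        then show ?thesis
          by (auto simp: vec.span_insert) (metis add_diff_cancel_left')
      qed
    qed
    from bij_betw_same_card[OF this] show ?case
      using insert B by (simp add: card_cartesian_product)
  qed simp
  obtain B where "B \<subseteq> S" "vec.independent B" "S \<subseteq> vec.span B" "card B = vec.dim S"
    using vec.basis_exists by blast
  then show ?thesis
    using ind[of B] assms vec.span_minimal[of B S] by (metis finite subset_antisym)
qed

lemma one_less_card_field: "1 < CARD('a::{field,finite})"
  using card_mono[of UNIV "{0, 1 :: 'a}"] by simp

text \<open>Since q > 1, the power of q determines its exponent. Codimension thus becomes a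
  condition on cardinality, which is easy to follow through bijections.\<close>

lemma num_subalgebras_card:
  fixes L :: "'a::{field,finite} ^ 'b::finite \<Rightarrow> 'a ^ 'b \<Rightarrow> 'a ^ 'b"
  assumes "i + k = CARD('b)"
  shows "num_subalgebras L i = card {S. lie_subalgebra L S \<and> card S = CARD('a) ^ k}"
proof -
  have "vec.dim S + i = CARD('b) \<longleftrightarrow> card S = CARD('a) ^ k" if "lie_subalgebra L S" for S
    using card_subspace[of S] one_less_card_field[where 'a = 'a] that assms by (auto simp: lie_subalgebra_def)
  then show ?thesis
    unfolding num_subalgebras_def by (metis (no_types, lifting))
qed

lemma card_line:
  fixes v :: "'a::{field,finite} ^ 'b::finite"
  assumes "v \<noteq> 0"
  shows "card (range (\<lambda>c. c *s v)) = CARD('a)"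
  using assms by (intro card_image inj_onI) simp

lemma subspace_line: "vec.subspace (range (\<lambda>c. c *s (v :: 'a::field ^ 'b::finite)))"
proof -
  have "range (\<lambda>c. c *s v) = vec.span {v}"
    by (auto simp: vec.span_singleton)
  then show ?thesis by simp
qed

lemma subspace_card_eq_line:
  fixes v :: "'a::{field,finite} ^ 'b::finite"
  assumes "vec.subspace S" "card S = CARD('a)" "v \<in> S" "v \<noteq> 0"
  shows "S = range (\<lambda>c. c *s v)"
proof -
  have "range (\<lambda>c. c *s v) \<subseteq> S"
    using assms by (auto intro: vec.subspace_scale)
  then show ?thesis
    using card_subset_eq[of S] card_line[of v] assms by auto
qed

text \<open>Distinct lines meet only in 0, so the nonzero vectors are partitioned into blocks of
  size q - 1, one for each line. The quotient of q^n - 1 by q - 1 is the geometric sum.\<close>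

lemma card_lines:
  "card {S :: ('a::{field,finite} ^ 'b::finite) set. vec.subspace S \<and> card S = CARD('a)}
     = (\<Sum>i<CARD('b). CARD('a) ^ i)"
proof -
  \<comment> \<open>Writing q as \<open>Suc m\<close> keeps truncated subtraction out of the
    induction.\<close>
  have geometric: "(\<Sum>i<n. Suc m ^ i) * m = Suc m ^ n - 1" for m n :: nat
    by (induction n) (simp_all add: algebra_simps)
  let ?P = "{S :: ('a ^ 'b) set. vec.subspace S \<and> card S = CARD('a)}"
  have "card (\<Union>S\<in>?P. S - {0}) = (\<Sum>S\<in>?P. card (S - {0}))"
  proof (rule card_UN_disjoint)
    show "\<forall>S\<in>?P. \<forall>T\<in>?P. S \<noteq> T \<longrightarrow> (S - {0}) \<inter> (T - {0}) = {}"
      using subspace_card_eq_line by blast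
  qed auto
  also have "\<dots> = card ?P * (CARD('a) - 1)"
    by (simp add: vec.subspace_0 card_Diff_singleton)
  also have "(\<Union>S\<in>?P. S - {0}) = UNIV - {0 :: 'a ^ 'b}"
  proof -
    have "\<exists>S\<in>?P. v \<in> S - {0}" if "v \<noteq> 0" for v :: "'a ^ 'b"
      using that card_line[OF that] subspace_line[of v] rangeI[of "\<lambda>c. c *s v" 1]
      by (intro bexI[of _ "range (\<lambda>c. c *s v)"]) auto
    then show ?thesis by auto
  qed
  finally have "card ?P * (CARD('a) - 1) = CARD('a) ^ CARD('b) - 1"
    by (simp add: card_Diff_singleton)
  also have "\<dots> = (\<Sum>i<CARD('b). CARD('a) ^ i) * (CARD('a) - 1)"
    using geometric[of "CARD('a) - 1" "CARD('b)"] by simp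
  finally show ?thesis
    using one_less_card_field[where 'a = 'a] by simp
qed

text \<open>Two vectors on a line are proportional, so the assumption makes their bracket vanish.
  Counting one-dimensional subalgebras becomes counting lines.\<close>

lemma lie_subalgebras_lines:
  fixes L :: "'a::{field,finite} ^ 'b::finite \<Rightarrow> 'a ^ 'b \<Rightarrow> 'a ^ 'b"
  assumes "\<And>c d x. L (c *s x) (d *s x) = 0"
  shows "{S. lie_subalgebra L S \<and> card S = CARD('a)} = {S. vec.subspace S \<and> card S = CARD('a)}"
proof -
  have "L x y \<in> S" if S: "vec.subspace S" "card S = CARD('a)" and "x \<in> S" "y \<in> S" for S x y
  proof (cases "x = 0")
    case True
    then show ?thesis
      using assms[of 0 y 1] S by (simp add: vec.subspace_0)
  next
    case False
    then obtain d where "y = d *s x"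
      using subspace_card_eq_line[OF S \<open>x \<in> S\<close>] \<open>y \<in> S\<close> by auto
    then show ?thesis
      using assms[of 1 x d] S by (simp add: vec.subspace_0)
  qed
  then show ?thesis by (auto simp: lie_subalgebra_def)
qed

lemma lie_subalgebras_zero:
  fixes L :: "'a::{field,finite} ^ 'b::finite \<Rightarrow> 'a ^ 'b \<Rightarrow> 'a ^ 'b"
  assumes "L 0 0 = 0"
  shows "{S. lie_subalgebra L S \<and> card S = 1} = {{0}}"
  using assms vec.subspace_0 by (fastforce simp: lie_subalgebra_def card_1_singleton_iff vec.subspace_single_0)

lemma lie_subalgebras_UNIV:
  fixes L :: "'a::{field,finite} ^ 'b::finite \<Rightarrow> 'a ^ 'b \<Rightarrow> 'a ^ 'b"
  shows "{S. lie_subalgebra L S \<and> card S = CARD('a) ^ CARD('b)} = {UNIV}"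
  using card_subset_eq[of "UNIV :: ('a ^ 'b) set"] by (auto simp: lie_subalgebra_def)

section \<open>Subalgebras of $\mathfrak{sl}_2$\<close>

lemma base_change_sl2_nth:
  "base_change sl2 x y $ Se = 2 * (x $ Sh * y $ Se - x $ Se * y $ Sh)"
  "base_change sl2 x y $ Sf = 2 * (x $ Sf * y $ Sh - x $ Sh * y $ Sf)"
  "base_change sl2 x y $ Sh = x $ Se * y $ Sf - x $ Sf * y $ Se"
  by (simp_all add: base_change_def UNIV_sl2_basis of_int_vec_def sl2_nth axis_def algebra_simps)

definition sl2_vec :: "'a \<Rightarrow> 'a \<Rightarrow> 'a \<Rightarrow> 'a ^ sl2_basis" where
  "sl2_vec a b c = (\<chi> i. case i of Se \<Rightarrow> a | Sf \<Rightarrow> b | Sh \<Rightarrow> c)"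

lemma sl2_vec_nth [simp]:
  "sl2_vec a b c $ Se = a" "sl2_vec a b c $ Sf = b" "sl2_vec a b c $ Sh = c"
  by (simp_all add: sl2_vec_def)

lemma sl2_vec_eq_iff: "x = y \<longleftrightarrow> x $ Se = y $ Se \<and> x $ Sf = y $ Sf \<and> x $ Sh = y $ Sh"
  by (simp add: vec_eq_iff all_sl2_basis)

lemma card_sl2_basis: "CARD(sl2_basis) = 3"
  by (simp add: UNIV_sl2_basis)

text \<open>\<open>sl2_plane b\<close> has the normal vector \<open>(1, - b\<^sup>2, 2 b)\<close>, which runs through the affine points of
  the conic \<open>4 \<xi>\<^sub>e \<xi>\<^sub>f + \<xi>\<^sub>h\<^sup>2 = 0\<close>; its point at infinity gives \<open>sl2_plane_infinity\<close>.\<close>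

definition sl2_plane :: "'a::comm_ring_1 \<Rightarrow> ('a ^ sl2_basis) set" where
  "sl2_plane b = {x. x $ Se = b\<^sup>2 * x $ Sf - 2 * b * x $ Sh}"

definition sl2_plane_infinity :: "('a::zero ^ sl2_basis) set" where
  "sl2_plane_infinity = {x. x $ Sf = 0}"

lemma card_sl2_plane: "card (sl2_plane (b :: 'a::{field,finite})) = CARD('a)\<^sup>2"
proof -
  have "bij_betw (\<lambda>(y, z). sl2_vec (b\<^sup>2 * y - 2 * b * z) y z) UNIV (sl2_plane b)"
    by (rule bij_betw_byWitness[where f' = "\<lambda>x. (x $ Sf, x $ Sh)"])
      (auto simp: sl2_plane_def sl2_vec_eq_iff)
  from bij_betw_same_card[OF this] show ?thesis
    by (simp add: card_prod power2_eq_square)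
qed

lemma card_sl2_plane_infinity:
  "card (sl2_plane_infinity :: ('a::{field,finite} ^ sl2_basis) set) = CARD('a)\<^sup>2"
proof -
  have "bij_betw (\<lambda>(x, z). sl2_vec x 0 z) UNIV (sl2_plane_infinity :: ('a ^ sl2_basis) set)"
    by (rule bij_betw_byWitness[where f' = "\<lambda>x. (x $ Se, x $ Sh)"])
      (auto simp: sl2_plane_infinity_def sl2_vec_eq_iff)
  from bij_betw_same_card[OF this] show ?thesis
    by (simp add: card_prod power2_eq_square)
qed

lemma lie_subalgebra_sl2_plane: "lie_subalgebra (base_change sl2) (sl2_plane (b :: 'a::field))"
proof -
  have "vec.subspace (sl2_plane b)"
    by (auto simp: vec.subspace_def sl2_plane_def) (simp_all add: algebra_simps)
  moreover have "base_change sl2 x y \<in> sl2_plane b" if "x \<in> sl2_plane b" "y \<in> sl2_plane b" for x y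
  proof -
    have *: "x $ Se = b\<^sup>2 * x $ Sf - 2 * b * x $ Sh" "y $ Se = b\<^sup>2 * y $ Sf - 2 * b * y $ Sh"
      using that by (simp_all add: sl2_plane_def)
    show ?thesis
      unfolding sl2_plane_def mem_Collect_eq base_change_sl2_nth *
      by (simp add: power2_eq_square algebra_simps)
  qed
  ultimately show ?thesis
    by (simp add: lie_subalgebra_def)
qed

lemma lie_subalgebra_sl2_plane_infinity:
  "lie_subalgebra (base_change sl2) (sl2_plane_infinity :: ('a::field ^ sl2_basis) set)"
  unfolding lie_subalgebra_def vec.subspace_def sl2_plane_infinity_def
  by (auto simp: base_change_sl2_nth)

lemma inj_sl2_plane: "inj (sl2_plane :: 'a::field \<Rightarrow> _)"
proof (rule injI)
  fix b c :: 'a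
  assume eq: "sl2_plane b = sl2_plane c"
  have "sl2_vec (b\<^sup>2) 1 0 \<in> sl2_plane b" "sl2_vec (- 2 * b) 0 1 \<in> sl2_plane b"
    by (simp_all add: sl2_plane_def)
  then have *: "b\<^sup>2 = c\<^sup>2" "2 * b = 2 * c"
    unfolding eq by (simp_all add: sl2_plane_def)
  \<comment> \<open>The cross term is grouped as \<open>c * (2 * b)\<close> so that both equations
    apply without dividing by 2.\<close>
  have "(b - c)\<^sup>2 = b\<^sup>2 + c\<^sup>2 - c * (2 * b)"
    by (simp add: power2_eq_square algebra_simps)
  also have "\<dots> = c\<^sup>2 + c\<^sup>2 - c * (2 * c)"
    by (simp only: *)
  finally have "(b - c)\<^sup>2 = 0"
    by (simp add: power2_eq_square)
  then show "b = c" by simp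
qed

lemma sl2_plane_neq_infinity: "sl2_plane (b :: 'a::field) \<noteq> sl2_plane_infinity"
proof
  assume eq: "sl2_plane b = sl2_plane_infinity"
  have "sl2_vec (b\<^sup>2) 1 0 \<in> sl2_plane b"
    by (auto simp: sl2_plane_def)
  then show False
    unfolding eq by (simp add: sl2_plane_infinity_def)
qed

section \<open>Classification of two-dimensional subalgebras by normal vectors\<close>

definition sl2_cross :: "'a::comm_ring_1 ^ sl2_basis \<Rightarrow> 'a ^ sl2_basis \<Rightarrow> 'a ^ sl2_basis" where
  "sl2_cross x y = sl2_vec (x $ Sf * y $ Sh - x $ Sh * y $ Sf)
     (x $ Sh * y $ Se - x $ Se * y $ Sh) (x $ Se * y $ Sf - x $ Sf * y $ Se)"

definition sl2_dot :: "'a::comm_ring_1 ^ sl2_basis \<Rightarrow> 'a ^ sl2_basis \<Rightarrow> 'a" where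
  "sl2_dot x y = x $ Se * y $ Se + x $ Sf * y $ Sf + x $ Sh * y $ Sh"

text \<open>This is Cramer's rule: the factor of \<open>w\<close> is the determinant of
  \<open>x\<close>, \<open>y\<close>, \<open>z\<close>, and each coefficient on the right is that
  determinant with one of the three vectors replaced by \<open>w\<close>.\<close>

lemma sl2_cramer:
  "sl2_dot (sl2_cross x y) z *s w =
     sl2_dot (sl2_cross y z) w *s x + sl2_dot (sl2_cross z x) w *s y + sl2_dot (sl2_cross x y) w *s z"
  by (simp add: sl2_vec_eq_iff sl2_dot_def sl2_cross_def algebra_simps)

text \<open>With a nonzero determinant, Cramer's rule would write every vector as a combination of
  \<open>x\<close>, \<open>y\<close>, \<open>z\<close>, forcing \<open>S\<close> to be the whole
  space.\<close>

lemma sl2_dot_eq_0: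
  assumes S: "vec.subspace (S :: ('a::field ^ sl2_basis) set)" "S \<noteq> UNIV" and "x \<in> S" "y \<in> S" "z \<in> S"
  shows "sl2_dot (sl2_cross x y) z = 0"
proof (rule ccontr)
  assume d: "sl2_dot (sl2_cross x y) z \<noteq> 0"
  have "w \<in> S" for w
  proof -
    have "sl2_dot (sl2_cross x y) z *s w \<in> S"
      using assms by (subst sl2_cramer) (intro vec.subspace_add vec.subspace_scale)
    from vec.subspace_scale[OF S(1) this, of "inverse (sl2_dot (sl2_cross x y) z)"] d show ?thesis
      by (simp add: vector_smult_assoc)
  qed
  with S show False by auto
qed

text \<open>Vanishing of all 2 x 2 minors makes \<open>x $ i *s y\<close> equal to
  \<open>y $ i *s x\<close> for each \<open>i\<close>; it remains to divide by a nonzero coordinate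
  of \<open>x\<close>.\<close>

lemma sl2_cross_eq_0:
  assumes "sl2_cross x y = (0 :: 'a::field ^ sl2_basis)" "x \<noteq> 0"
  shows "\<exists>c. y = c *s x"
proof -
  have "x $ i *s y = y $ i *s x" for i
    using assms(1) by (cases i) (simp_all add: sl2_cross_def sl2_vec_eq_iff mult.commute)
  moreover obtain i where "x $ i \<noteq> 0"
    using assms(2) by (auto simp: vec_eq_iff)
  ultimately have "y = (inverse (x $ i) * y $ i) *s x"
    by (metis left_inverse vector_smult_assoc vector_smult_lid)
  then show ?thesis ..
qed

text \<open>For independent \<open>x\<close>, \<open>y\<close> in \<open>S\<close>, the plane
  \<open>S\<close> is orthogonal to \<open>n = sl2_cross x y\<close>, and closure under the bracket
  forces \<open>n\<close> onto the conic. If \<open>n $ Se\<close> is 0, then \<open>n\<close> is a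
  multiple of the point at infinity; otherwise it can be scaled to the affine form. Both planes have
  q^2 elements, so inclusion of \<open>S\<close> is equality.\<close>

lemma lie_subalgebra_sl2_cases:
  fixes S :: "('a::{field,finite} ^ sl2_basis) set"
  assumes two: "(2 :: 'a) \<noteq> 0"
    and S: "lie_subalgebra (base_change sl2) S" "card S = CARD('a)\<^sup>2"
  shows "S = sl2_plane_infinity \<or> (\<exists>b. S = sl2_plane b)"
proof -
  have sub: "vec.subspace S" and closed: "\<And>x y. x \<in> S \<Longrightarrow> y \<in> S \<Longrightarrow> base_change sl2 x y \<in> S"
    using S by (auto simp: lie_subalgebra_def)
  have q: "1 < CARD('a)" by (rule one_less_card_field)
  have "S \<noteq> UNIV"
    using S(2) q by (auto simp: card_sl2_basis)
  \<comment> \<open>Two independent vectors exist because q^2 exceeds both 1 and q, so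
    \<open>S\<close> fits neither in the zero space nor in a line.\<close>
  have "\<exists>x\<in>S. x \<noteq> 0"
  proof (rule ccontr)
    assume "\<not> ?thesis"
    then have "S \<subseteq> {0}" by auto
    from card_mono[OF _ this] show False
      using S(2) less_1_mult[OF q q] by (simp add: power2_eq_square)
  qed
  then obtain x where x: "x \<in> S" "x \<noteq> 0" by blast
  have "\<exists>y\<in>S. sl2_cross x y \<noteq> 0"
  proof (rule ccontr)
    assume "\<not> ?thesis"
    then have "S \<subseteq> range (\<lambda>c. c *s x)"
      using sl2_cross_eq_0[OF _ x(2)] by blast
    from card_mono[OF _ this] show False
      using S(2) q card_line[OF x(2)] by (simp add: power2_eq_square)
  qed
  then obtain y where y: "y \<in> S" "sl2_cross x y \<noteq> 0" by blast
  define n where "n = sl2_cross x y"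
  have dot: "sl2_dot n z = 0" if "z \<in> S" for z
    unfolding n_def using sl2_dot_eq_0[OF sub \<open>S \<noteq> UNIV\<close> x(1) y(1) that] .
  \<comment> \<open>The bracket of \<open>x\<close> and \<open>y\<close> has coordinates
    \<open>2 * n $ Sf\<close>, \<open>2 * n $ Se\<close>, \<open>n $ Sh\<close>; pairing it with
    \<open>n\<close> yields the quadratic form of the conic.\<close>
  have "sl2_dot n (base_change sl2 x y) = 4 * n $ Se * n $ Sf + (n $ Sh)\<^sup>2"
    by (simp add: n_def sl2_dot_def base_change_sl2_nth sl2_cross_def power2_eq_square algebra_simps)
  then have conic: "4 * n $ Se * n $ Sf + (n $ Sh)\<^sup>2 = 0"
    using dot[OF closed[OF x(1) y(1)]] by simp
  show ?thesis
  proof (cases "n $ Se = 0")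
    case True
    with conic y have "n $ Sh = 0" "n $ Sf \<noteq> 0"
      by (auto simp: n_def[symmetric] sl2_vec_eq_iff)
    then have "S \<subseteq> sl2_plane_infinity"
      using dot True by (auto simp: sl2_dot_def sl2_plane_infinity_def)
    then have "S = sl2_plane_infinity"
      by (intro card_subset_eq) (auto simp: S card_sl2_plane_infinity)
    then show ?thesis ..
  next
    case False
    \<comment> \<open>The value is read off from requiring \<open>n\<close> to be
      \<open>n $ Se\<close> times (1, -b^2, 2b).\<close>
    define b where "b = n $ Sh / (2 * n $ Se)"
    have Sh: "n $ Sh = 2 * b * n $ Se"
      using False two by (simp add: b_def)
    have "4 * n $ Se * (n $ Sf + b\<^sup>2 * n $ Se) = 0"
      using conic unfolding Sh by (simp add: power2_eq_square algebra_simps)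
    moreover have "(4 :: 'a) \<noteq> 0"
      using two no_zero_divisors[of "2::'a" 2] by simp
    ultimately have Sf: "n $ Sf = - b\<^sup>2 * n $ Se"
      using False by (simp add: eq_neg_iff_add_eq_0)
    have "z \<in> sl2_plane b" if "z \<in> S" for z
    proof -
      have "n $ Se * (z $ Se - (b\<^sup>2 * z $ Sf - 2 * b * z $ Sh)) = 0"
        using dot[OF that] unfolding sl2_dot_def Sf Sh by (simp add: algebra_simps)
      with False show ?thesis by (simp add: sl2_plane_def)
    qed
    then have "S = sl2_plane b"
      by (intro card_subset_eq) (auto simp: S card_sl2_plane)
    then show ?thesis by blast
  qed
qed

lemma lie_subalgebras_sl2_planes:
  assumes "(2 :: 'a::{field,finite}) \<noteq> 0"
  shows "{S. lie_subalgebra (base_change sl2) S \<and> card S = CARD('a)\<^sup>2} =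
    insert sl2_plane_infinity (range (sl2_plane :: 'a \<Rightarrow> _))"
  using lie_subalgebra_sl2_cases[OF assms] lie_subalgebra_sl2_plane[where 'a = 'a]
    lie_subalgebra_sl2_plane_infinity[where 'a = 'a] card_sl2_plane[where 'a = 'a]
    card_sl2_plane_infinity[where 'a = 'a] by blast

lemma card_lie_subalgebras_sl2_planes:
  assumes "(2 :: 'a::{field,finite}) \<noteq> 0"
  shows "card {S. lie_subalgebra (base_change sl2 :: 'a ^ _ \<Rightarrow> _) S \<and> card S = CARD('a)\<^sup>2} = CARD('a) + 1"
  unfolding lie_subalgebras_sl2_planes[OF assms] using sl2_plane_neq_infinity[where 'a = 'a]
  by (subst card_insert_disjoint) (auto simp: card_image[OF inj_sl2_plane])

lemma card_lie_subalgebras_sl2_lines: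
  "card {S. lie_subalgebra (base_change sl2 :: 'a::{field,finite} ^ _ \<Rightarrow> _) S \<and> card S = CARD('a)}
     = 1 + CARD('a) + CARD('a)\<^sup>2" (is "card ?A = _")
proof -
  have "?A = {S. vec.subspace S \<and> card S = CARD('a)}"
    by (rule lie_subalgebras_lines) (simp add: sl2_vec_eq_iff base_change_sl2_nth)
  then show ?thesis
    using card_lines[where 'a = 'a and 'b = sl2_basis]
    by (simp add: card_sl2_basis eval_nat_numeral)
qed

section \<open>Subalgebras of $\mathfrak{gl}_2$\<close>

lemma base_change_gl2_nth:
  "base_change gl2 x y $ Ge = 2 * (x $ Gh * y $ Ge - x $ Ge * y $ Gh)"
  "base_change gl2 x y $ Gf = 2 * (x $ Gf * y $ Gh - x $ Gh * y $ Gf)"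
  "base_change gl2 x y $ Gh = x $ Ge * y $ Gf - x $ Gf * y $ Ge"
  "base_change gl2 x y $ Gg = 0"
  by (simp_all add: base_change_def UNIV_gl2_basis of_int_vec_def gl2_nth axis_def algebra_simps)

text \<open>This stands for m + z g, so \<open>gl2_vec 0 1\<close> is the central generator
  g.\<close>

definition gl2_vec :: "'a ^ sl2_basis \<Rightarrow> 'a \<Rightarrow> 'a ^ gl2_basis" where
  "gl2_vec m z = (\<chi> i. case i of Ge \<Rightarrow> m $ Se | Gf \<Rightarrow> m $ Sf | Gh \<Rightarrow> m $ Sh | Gg \<Rightarrow> z)"

definition gl2_proj :: "'a ^ gl2_basis \<Rightarrow> 'a ^ sl2_basis" where
  "gl2_proj x = sl2_vec (x $ Ge) (x $ Gf) (x $ Gh)"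

lemma gl2_vec_nth [simp]:
  "gl2_vec m z $ Ge = m $ Se" "gl2_vec m z $ Gf = m $ Sf" "gl2_vec m z $ Gh = m $ Sh"
  "gl2_vec m z $ Gg = z"
  by (simp_all add: gl2_vec_def)

lemma gl2_proj_nth [simp]:
  "gl2_proj x $ Se = x $ Ge" "gl2_proj x $ Sf = x $ Gf" "gl2_proj x $ Sh = x $ Gh"
  by (simp_all add: gl2_proj_def)

lemma gl2_proj_vec [simp]: "gl2_proj (gl2_vec m z) = m"
  by (simp add: sl2_vec_eq_iff)

lemma gl2_eq_iff: "x = y \<longleftrightarrow> gl2_proj x = gl2_proj y \<and> x $ Gg = y $ Gg"
  by (auto simp: vec_eq_iff all_gl2_basis all_sl2_basis)

lemma card_gl2_basis: "CARD(gl2_basis) = 4"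
  by (simp add: UNIV_gl2_basis)

lemma gl2_proj_simps:
  "gl2_proj 0 = (0 :: 'a::comm_ring_1 ^ sl2_basis)"
  "gl2_proj (x + y) = gl2_proj x + (gl2_proj y :: 'a ^ sl2_basis)"
  "gl2_proj (x - y) = gl2_proj x - (gl2_proj y :: 'a ^ sl2_basis)"
  "gl2_proj (c *s x) = c *s (gl2_proj x :: 'a ^ sl2_basis)"
  "gl2_proj (base_change gl2 x y) = base_change sl2 (gl2_proj x) (gl2_proj y :: 'a ^ sl2_basis)"
  by (simp_all add: sl2_vec_eq_iff base_change_sl2_nth base_change_gl2_nth)

lemma surj_gl2_proj: "surj gl2_proj"
  by (rule surjI[where f = "\<lambda>m. gl2_vec m undefined"]) simp

lemma card_gl2_proj_vimage:
  "card (gl2_proj -` (M :: ('a::finite ^ sl2_basis) set)) = CARD('a) * card M"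
proof -
  have "bij_betw (\<lambda>(m, z). gl2_vec m z) (M \<times> UNIV) (gl2_proj -` M)"
    by (rule bij_betw_byWitness[where f' = "\<lambda>x. (gl2_proj x, x $ Gg)"]) (auto simp: gl2_eq_iff)
  from bij_betw_same_card[OF this] show ?thesis
    by (simp add: card_cartesian_product mult.commute)
qed

section \<open>Transfer of subalgebras along the projection\<close>

lemma lie_subalgebra_gl2_proj_vimage:
  "lie_subalgebra (base_change sl2) M \<Longrightarrow> lie_subalgebra (base_change gl2) (gl2_proj -` M)"
  by (simp add: lie_subalgebra_def vec.subspace_def gl2_proj_simps)

lemma lie_subalgebra_gl2_proj_image:
  assumes "lie_subalgebra (base_change gl2) S"
  shows "lie_subalgebra (base_change sl2) (gl2_proj ` S)"
proof -
  have S: "0 \<in> S" "\<And>x y. x \<in> S \<Longrightarrow> y \<in> S \<Longrightarrow> x + y \<in> S" "\<And>c x. x \<in> S \<Longrightarrow> c *s x \<in> S"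
    "\<And>x y. x \<in> S \<Longrightarrow> y \<in> S \<Longrightarrow> base_change gl2 x y \<in> S"
    using assms by (auto simp: lie_subalgebra_def vec.subspace_def)
  have "0 \<in> gl2_proj ` S"
    using S(1) gl2_proj_simps(1) by (metis imageI)
  then show ?thesis
    using S unfolding lie_subalgebra_def vec.subspace_def
    by (auto simp flip: gl2_proj_simps)
qed

text \<open>The fibres of \<open>gl2_proj\<close> are the cosets of the central line, so a subspace
  containing g is a union of fibres.\<close>

lemma gl2_proj_vimage_image:
  fixes S :: "('a::field ^ gl2_basis) set"
  assumes "vec.subspace S" "gl2_vec 0 1 \<in> S"
  shows "gl2_proj -` (gl2_proj ` S) = S"
proof -
  have "x \<in> S" if "y \<in> S" "gl2_proj x = gl2_proj y" for x y
  proof -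
    have "x = y + (x $ Gg - y $ Gg) *s gl2_vec 0 1"
      using that(2) by (simp add: gl2_eq_iff gl2_proj_simps)
    also have "\<dots> \<in> S"
      using assms that(1) by (intro vec.subspace_add vec.subspace_scale)
    finally show ?thesis .
  qed
  then show ?thesis by auto
qed

text \<open>Two points of \<open>S\<close> in one fibre differ by a multiple of g; a nonzero
  multiple would put g itself into \<open>S\<close>.\<close>

lemma inj_on_gl2_proj:
  fixes S :: "('a::field ^ gl2_basis) set"
  assumes "vec.subspace S" "gl2_vec 0 1 \<notin> S"
  shows "inj_on gl2_proj S"
proof (rule inj_onI, rule ccontr)
  fix x y
  assume xy: "x \<in> S" "y \<in> S" "gl2_proj x = gl2_proj y" "x \<noteq> y"
  then have "x $ Gg \<noteq> y $ Gg"
    by (auto simp: gl2_eq_iff)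
  then have "gl2_vec 0 1 = inverse (x $ Gg - y $ Gg) *s (x - y)"
    by (simp add: gl2_eq_iff gl2_proj_simps xy(3) flip: right_diff_distrib)
  also have "\<dots> \<in> S"
    using assms xy by (intro vec.subspace_scale vec.subspace_diff)
  finally show False
    using assms(2) by simp
qed

text \<open>Taking preimages and taking images are mutually inverse here, and a preimage is q times
  as large as the original set.\<close>

lemma card_central_lie_subalgebras_gl2:
  "card {S. lie_subalgebra (base_change gl2 :: 'a::{field,finite} ^ _ \<Rightarrow> _) S \<and> card S = CARD('a) * n
       \<and> gl2_vec 0 1 \<in> S}
     = card {M. lie_subalgebra (base_change sl2 :: 'a ^ _ \<Rightarrow> _) M \<and> card M = n}"
  (is "card ?A = card ?B")
proof -
  have "bij_betw ((-`) gl2_proj) ?B ?A"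
  proof (rule bij_betw_byWitness[where f' = "(`) gl2_proj"])
    show "\<forall>M\<in>?B. gl2_proj ` gl2_proj -` M = M"
      by (simp add: surj_image_vimage_eq surj_gl2_proj)
    show *: "\<forall>S\<in>?A. gl2_proj -` gl2_proj ` S = S"
      by (simp add: gl2_proj_vimage_image lie_subalgebra_def)
    show "(-`) gl2_proj ` ?B \<subseteq> ?A"
      by (auto simp: lie_subalgebra_gl2_proj_vimage card_gl2_proj_vimage)
        (simp add: lie_subalgebra_def vec.subspace_0)
    show "(`) gl2_proj ` ?A \<subseteq> ?B"
    proof clarify
      fix S :: "('a ^ gl2_basis) set"
      assume S: "lie_subalgebra (base_change gl2) S" "card S = CARD('a) * n" "gl2_vec 0 1 \<in> S"
      then have "CARD('a) * card (gl2_proj ` S) = CARD('a) * n"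
        using * card_gl2_proj_vimage[of "gl2_proj ` S"] by simp
      then show "lie_subalgebra (base_change sl2) (gl2_proj ` S) \<and> card (gl2_proj ` S) = n"
        using S by (simp add: lie_subalgebra_gl2_proj_image)
    qed
  qed
  from bij_betw_same_card[OF this] show ?thesis by simp
qed

section \<open>Subalgebras without the central element as graphs of characters\<close>

definition gl2_graph :: "('a ^ sl2_basis) set \<Rightarrow> ('a ^ sl2_basis \<Rightarrow> 'a) \<Rightarrow> ('a ^ gl2_basis) set" where
  "gl2_graph M \<phi> = {x. gl2_proj x \<in> M \<and> x $ Gg = \<phi> (gl2_proj x)}"

lemma gl2_proj_graph: "gl2_proj ` gl2_graph M \<phi> = M"
proof -
  have "m \<in> gl2_proj ` gl2_graph M \<phi>" if "m \<in> M" for m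
    using that by (intro image_eqI[of _ _ "gl2_vec m (\<phi> m)"]) (simp_all add: gl2_graph_def)
  then show ?thesis by (auto simp: gl2_graph_def)
qed

lemma card_gl2_graph: "card (gl2_graph M \<phi>) = card M"
proof -
  have "inj_on gl2_proj (gl2_graph M \<phi>)"
    by (rule inj_onI) (simp add: gl2_graph_def gl2_eq_iff)
  from card_image[OF this] show ?thesis
    by (simp add: gl2_proj_graph)
qed

lemma gl2_vec_in_graph_iff: "gl2_vec m z \<in> gl2_graph M \<phi> \<longleftrightarrow> m \<in> M \<and> z = \<phi> m"
  by (simp add: gl2_graph_def)

lemma gl2_graph_cong: "(\<And>m. m \<in> M \<Longrightarrow> \<phi> m = \<psi> m) \<Longrightarrow> gl2_graph M \<phi> = gl2_graph M \<psi>"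
  by (auto simp: gl2_graph_def)

text \<open>The graph of \<open>\<phi>\<close> on \<open>M\<close> is a subalgebra iff \<open>\<phi>\<close> is a character of \<open>M\<close>.\<close>

definition sl2_character :: "('a::comm_ring_1 ^ sl2_basis) set \<Rightarrow> ('a ^ sl2_basis \<Rightarrow> 'a) \<Rightarrow> bool" where
  "sl2_character M \<phi> \<longleftrightarrow> (\<forall>x\<in>M. \<forall>y\<in>M. \<phi> (x + y) = \<phi> x + \<phi> y) \<and> (\<forall>c. \<forall>x\<in>M. \<phi> (c *s x) = c * \<phi> x) \<and>
     (\<forall>x\<in>M. \<forall>y\<in>M. \<phi> (base_change sl2 x y) = 0)"

text \<open>Brackets in gl2 have g-coordinate 0, so the graph is closed under them exactly because
  \<phi> kills brackets in \<open>M\<close>. The element g lies over 0, where the graph has only the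
  value \<open>\<phi> 0 = 0\<close>.\<close>

lemma lie_subalgebra_gl2_graph:
  assumes M: "lie_subalgebra (base_change sl2) (M :: ('a::field ^ sl2_basis) set)"
    and \<phi>: "sl2_character M \<phi>"
  shows "lie_subalgebra (base_change gl2) (gl2_graph M \<phi>)" "gl2_vec 0 1 \<notin> gl2_graph M \<phi>"
proof -
  have "0 \<in> M"
    using M by (simp add: lie_subalgebra_def vec.subspace_0)
  then have "\<phi> (0 *s 0) = 0 * \<phi> 0"
    using \<phi> unfolding sl2_character_def by blast
  then have "\<phi> 0 = 0" by simp
  then show "gl2_vec 0 1 \<notin> gl2_graph M \<phi>"
    by (simp add: gl2_vec_in_graph_iff)
  show "lie_subalgebra (base_change gl2) (gl2_graph M \<phi>)"
    using M \<phi> \<open>\<phi> 0 = 0\<close>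
    by (simp add: lie_subalgebra_def vec.subspace_def gl2_graph_def gl2_proj_simps base_change_gl2_nth
        sl2_character_def)
qed

lemma noncentral_lie_subalgebra_gl2:
  fixes S :: "('a::field ^ gl2_basis) set"
  assumes S: "lie_subalgebra (base_change gl2) S" "gl2_vec 0 1 \<notin> S"
  obtains \<phi> where "sl2_character (gl2_proj ` S) \<phi>" "S = gl2_graph (gl2_proj ` S) \<phi>"
proof -
  have inj: "inj_on gl2_proj S"
    using S by (intro inj_on_gl2_proj) (auto simp: lie_subalgebra_def)
  \<comment> \<open>The value at \<open>m\<close> is the g-coordinate of its unique lift to
    \<open>S\<close>. Values outside the image of \<open>S\<close> are arbitrary and do not affect
    the graph.\<close>
  define \<phi> where "\<phi> m = inv_into S gl2_proj m $ Gg" for m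
  have \<phi>: "\<phi> (gl2_proj x) = x $ Gg" if "x \<in> S" for x
    using inj that by (simp add: \<phi>_def)
  have "sl2_character (gl2_proj ` S) \<phi>"
    using S(1) unfolding sl2_character_def lie_subalgebra_def vec.subspace_def
    by (auto simp: \<phi> base_change_gl2_nth simp flip: gl2_proj_simps)
  moreover have "S = gl2_graph (gl2_proj ` S) \<phi>"
  proof
    show "S \<subseteq> gl2_graph (gl2_proj ` S) \<phi>"
      by (auto simp: gl2_graph_def \<phi>)
    show "gl2_graph (gl2_proj ` S) \<phi> \<subseteq> S"
    proof
      fix x assume "x \<in> gl2_graph (gl2_proj ` S) \<phi>"
      then obtain y where "y \<in> S" "gl2_proj x = gl2_proj y" "x $ Gg = \<phi> (gl2_proj y)"
        by (auto simp: gl2_graph_def)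
      then show "x \<in> S"
        using \<phi>[of y] gl2_eq_iff[of x y] by simp
    qed
  qed
  ultimately show ?thesis by (rule that)
qed

section \<open>Characters of the planes and of sl2\<close>

lemma sl2_character_plane_iff:
  assumes "(2 :: 'a::field) \<noteq> 0"
  shows "sl2_character (sl2_plane b) \<phi> \<longleftrightarrow>
    (\<exists>c :: 'a. \<forall>m\<in>sl2_plane b. \<phi> m = c * (m $ Sh - b * m $ Sf))"
proof
  \<comment> \<open>This basis of the plane is chosen so that the coefficients of \<open>m\<close>
    are its coordinates \<open>m $ Sf\<close> and \<open>m $ Sh\<close>.\<close>
  let ?s = "sl2_vec (b\<^sup>2) 1 0" and ?t = "sl2_vec (- 2 * b) 0 1"
  have st: "?s \<in> sl2_plane b" "?t \<in> sl2_plane b"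
    by (simp_all add: sl2_plane_def)
  have sub: "vec.subspace (sl2_plane b)"
    using lie_subalgebra_sl2_plane[of b] by (simp add: lie_subalgebra_def)
  assume \<phi>: "sl2_character (sl2_plane b) \<phi>"
  have comb: "\<phi> (k *s ?s + l *s ?t) = k * \<phi> ?s + l * \<phi> ?t" for k l
    using \<phi> st vec.subspace_scale[OF sub] unfolding sl2_character_def by metis
  \<comment> \<open>This bracket spans the derived algebra. Its vanishing under \<phi> determines
    \<open>\<phi> ?s\<close> from \<open>\<phi> ?t\<close>, so \<open>\<phi> ?t\<close> is the one
    free parameter c.\<close>
  have "base_change sl2 ?s ?t = 2 *s ?s + (2 * b) *s ?t"
    by (simp add: sl2_vec_eq_iff base_change_sl2_nth power2_eq_square)
  moreover have "\<phi> (base_change sl2 ?s ?t) = 0"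
    using \<phi> st unfolding sl2_character_def by blast
  ultimately have "2 * \<phi> ?s + (2 * b) * \<phi> ?t = 0"
    using comb by metis
  then have "2 * (\<phi> ?s + b * \<phi> ?t) = 0"
    by (simp only: distrib_left mult.assoc)
  then have "\<phi> ?s + b * \<phi> ?t = 0"
    using assms mult_eq_0_iff by blast
  then have s: "\<phi> ?s = - b * \<phi> ?t"
    by (simp add: eq_neg_iff_add_eq_0)
  have "\<phi> m = \<phi> ?t * (m $ Sh - b * m $ Sf)" if "m \<in> sl2_plane b" for m
  proof -
    have "m = (m $ Sf) *s ?s + (m $ Sh) *s ?t"
      using that by (simp add: sl2_vec_eq_iff sl2_plane_def)
    then have "\<phi> m = m $ Sf * \<phi> ?s + m $ Sh * \<phi> ?t"
      using comb by metis
    then show ?thesis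
      unfolding s by (simp add: algebra_simps)
  qed
  then show "\<exists>c. \<forall>m\<in>sl2_plane b. \<phi> m = c * (m $ Sh - b * m $ Sf)" by blast
next
  assume "\<exists>c. \<forall>m\<in>sl2_plane b. \<phi> m = c * (m $ Sh - b * m $ Sf)"
  then obtain c where \<phi>: "\<phi> m = c * (m $ Sh - b * m $ Sf)" if "m \<in> sl2_plane b" for m
    by blast
  have closed: "\<And>x y. x \<in> sl2_plane b \<Longrightarrow> y \<in> sl2_plane b \<Longrightarrow> x + y \<in> sl2_plane b"
    "\<And>k x. x \<in> sl2_plane b \<Longrightarrow> k *s x \<in> sl2_plane b"
    "\<And>x y. x \<in> sl2_plane b \<Longrightarrow> y \<in> sl2_plane b \<Longrightarrow> base_change sl2 x y \<in> sl2_plane b"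
    using lie_subalgebra_sl2_plane[of b] by (auto simp: lie_subalgebra_def vec.subspace_def)
  have "base_change sl2 x y $ Sh - b * base_change sl2 x y $ Sf = 0"
    if "x \<in> sl2_plane b" "y \<in> sl2_plane b" for x y
  proof -
    have *: "x $ Se = b\<^sup>2 * x $ Sf - 2 * b * x $ Sh" "y $ Se = b\<^sup>2 * y $ Sf - 2 * b * y $ Sh"
      using that by (simp_all add: sl2_plane_def)
    show ?thesis
      unfolding base_change_sl2_nth * by (simp add: power2_eq_square algebra_simps)
  qed
  then show "sl2_character (sl2_plane b) \<phi>"
    by (simp add: sl2_character_def \<phi> closed) (simp add: algebra_simps)
qed

text \<open>The plane is spanned by e and h with [h,e] = 2e, so a character kills e and its value on
  h is free.\<close>

lemma sl2_character_plane_infinity_iff: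
  assumes "(2 :: 'a::field) \<noteq> 0"
  shows "sl2_character sl2_plane_infinity \<phi> \<longleftrightarrow> (\<exists>c :: 'a. \<forall>m\<in>sl2_plane_infinity. \<phi> m = c * m $ Sh)"
proof
  let ?s = "sl2_vec 1 0 0" and ?t = "sl2_vec 0 0 1"
  have st: "?s \<in> sl2_plane_infinity" "?t \<in> sl2_plane_infinity"
    by (simp_all add: sl2_plane_infinity_def)
  have sub: "vec.subspace (sl2_plane_infinity :: ('a ^ _) set)"
    using lie_subalgebra_sl2_plane_infinity[where 'a = 'a] by (simp add: lie_subalgebra_def)
  assume \<phi>: "sl2_character sl2_plane_infinity \<phi>"
  have comb: "\<phi> (k *s ?s + l *s ?t) = k * \<phi> ?s + l * \<phi> ?t" for k l
    using \<phi> st vec.subspace_scale[OF sub] unfolding sl2_character_def by metis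
  have "base_change sl2 ?t ?s = 2 *s ?s + 0 *s ?t"
    by (simp add: sl2_vec_eq_iff base_change_sl2_nth)
  moreover have "\<phi> (base_change sl2 ?t ?s) = 0"
    using \<phi> st unfolding sl2_character_def by blast
  ultimately have "2 * \<phi> ?s + 0 * \<phi> ?t = 0"
    using comb by metis
  then have s: "\<phi> ?s = 0"
    using assms by simp
  have "\<phi> m = \<phi> ?t * m $ Sh" if "m \<in> sl2_plane_infinity" for m
  proof -
    have "m = (m $ Se) *s ?s + (m $ Sh) *s ?t"
      using that by (simp add: sl2_vec_eq_iff sl2_plane_infinity_def)
    then have "\<phi> m = m $ Se * \<phi> ?s + m $ Sh * \<phi> ?t"
      using comb by metis
    then show ?thesis
      unfolding s by (simp add: mult.commute)
  qed
  then show "\<exists>c. \<forall>m\<in>sl2_plane_infinity. \<phi> m = c * m $ Sh" by blast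
next
  assume "\<exists>c. \<forall>m\<in>sl2_plane_infinity. \<phi> m = c * m $ Sh"
  then show "sl2_character sl2_plane_infinity \<phi>"
    by (auto simp: sl2_character_def sl2_plane_infinity_def base_change_sl2_nth algebra_simps)
qed

text \<open>With 2 invertible, sl2 is perfect: 2e, 2f and h are brackets, so a character vanishes on
  a basis.\<close>

lemma sl2_character_UNIV_iff:
  assumes "(2 :: 'a::field) \<noteq> 0"
  shows "sl2_character UNIV \<phi> \<longleftrightarrow> \<phi> = (\<lambda>_. 0 :: 'a)"
proof
  let ?e = "sl2_vec 1 0 0" and ?f = "sl2_vec 0 1 0" and ?h = "sl2_vec 0 0 1"
  assume \<phi>: "sl2_character UNIV \<phi>"
  have "base_change sl2 ?h ?e = 2 *s ?e" "base_change sl2 ?f ?h = 2 *s ?f" "base_change sl2 ?e ?f = ?h"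
    by (simp_all add: sl2_vec_eq_iff base_change_sl2_nth)
  then have "2 * \<phi> ?e = 0" "2 * \<phi> ?f = 0" and h: "\<phi> ?h = 0"
    using \<phi> unfolding sl2_character_def by (metis UNIV_I)+
  then have ef: "\<phi> ?e = 0" "\<phi> ?f = 0"
    using assms by simp_all
  show "\<phi> = (\<lambda>_. 0)"
  proof
    fix m :: "'a ^ sl2_basis"
    have "m = m $ Se *s ?e + m $ Sf *s ?f + m $ Sh *s ?h"
      by (simp add: sl2_vec_eq_iff)
    then have "\<phi> m = \<phi> (m $ Se *s ?e + m $ Sf *s ?f + m $ Sh *s ?h)" by simp
    also have "\<dots> = 0"
      using \<phi> by (simp add: sl2_character_def ef h)
    finally show "\<phi> m = 0" .
  qed
qed (simp add: sl2_character_def)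

section \<open>Counting the subalgebras of gl2\<close>

lemma noncentral_lie_subalgebras_gl2:
  "{S :: ('a::{field,finite} ^ gl2_basis) set. lie_subalgebra (base_change gl2) S \<and> card S = n
       \<and> gl2_vec 0 1 \<notin> S}
     = (\<Union>M\<in>{M. lie_subalgebra (base_change sl2) M \<and> card M = n}. gl2_graph M ` Collect (sl2_character M))"
  (is "?A = ?B")
proof
  show "?A \<subseteq> ?B"
  proof clarify
    fix S :: "('a ^ gl2_basis) set"
    assume S: "lie_subalgebra (base_change gl2) S" "gl2_vec 0 1 \<notin> S" "n = card S"
    obtain \<phi> where \<phi>: "sl2_character (gl2_proj ` S) \<phi>" "S = gl2_graph (gl2_proj ` S) \<phi>"
      using noncentral_lie_subalgebra_gl2[OF S(1,2)] .
    have "card (gl2_proj ` S) = card S"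
      using card_gl2_graph[of "gl2_proj ` S" \<phi>] \<phi>(2) by simp
    with \<phi> lie_subalgebra_gl2_proj_image[OF S(1)]
    show "S \<in> (\<Union>M\<in>{M. lie_subalgebra (base_change sl2) M \<and> card M = card S}.
        gl2_graph M ` Collect (sl2_character M))"
      by (intro UN_I[of "gl2_proj ` S"]) auto
  qed
  show "?B \<subseteq> ?A"
    using lie_subalgebra_gl2_graph by (auto simp: card_gl2_graph)
qed

text \<open>A graph determines its base as its projection, so the families over different
  \<open>M\<close> are disjoint and their sizes add up.\<close>

lemma card_noncentral_lie_subalgebras_gl2:
  "card {S :: ('a::{field,finite} ^ gl2_basis) set. lie_subalgebra (base_change gl2) S \<and> card S = n
       \<and> gl2_vec 0 1 \<notin> S}
     = (\<Sum>M | lie_subalgebra (base_change sl2 :: 'a ^ _ \<Rightarrow> _) M \<and> card M = n.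
         card (gl2_graph M ` Collect (sl2_character M)))"
  unfolding noncentral_lie_subalgebras_gl2
proof (rule card_UN_disjoint)
  show "\<forall>M\<in>{M. lie_subalgebra (base_change sl2) M \<and> card M = n}.
      \<forall>N\<in>{M. lie_subalgebra (base_change sl2) M \<and> card M = n}. M \<noteq> N \<longrightarrow>
        gl2_graph M ` Collect (sl2_character M) \<inter>
        gl2_graph N ` Collect (sl2_character (N :: ('a ^ _) set)) = {}"
  proof (intro ballI impI)
    fix M N :: "('a ^ sl2_basis) set"
    assume "M \<noteq> N"
    then have "gl2_graph M \<phi> \<noteq> gl2_graph N \<psi>" for \<phi> \<psi>
      by (metis gl2_proj_graph)
    then show "gl2_graph M ` Collect (sl2_character M) \<inter> gl2_graph N ` Collect (sl2_character N) = {}"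
      by (auto simp: disjoint_iff)
  qed
qed auto

text \<open>Graphs are counted instead of functions, which identifies characters agreeing on
  \<open>M\<close>. The scalar c is recovered from the graph as the value over \<open>m\<close>,
  where \<open>k\<close> is 1.\<close>

lemma card_gl2_graphs:
  fixes k :: "'a::{field,finite} ^ sl2_basis \<Rightarrow> 'a"
  assumes characters: "\<And>\<phi>. sl2_character M \<phi> \<longleftrightarrow> (\<exists>c. \<forall>m\<in>M. \<phi> m = c * k m)"
    and m: "m \<in> M" "k m = 1"
  shows "card (gl2_graph M ` Collect (sl2_character M)) = CARD('a)"
proof -
  let ?g = "\<lambda>c. gl2_graph M (\<lambda>m. c * k m)"
  have "gl2_graph M ` Collect (sl2_character M) = range ?g"
  proof (intro subset_antisym subsetI)
    fix S assume "S \<in> gl2_graph M ` Collect (sl2_character M)"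
    then obtain \<phi> c where "S = gl2_graph M \<phi>" "\<forall>m\<in>M. \<phi> m = c * k m"
      using characters by blast
    then have "S = ?g c"
      using gl2_graph_cong[of M \<phi> "\<lambda>m. c * k m"] by simp
    then show "S \<in> range ?g" by simp
  next
    fix S assume "S \<in> range ?g"
    then obtain c where "S = ?g c" by blast
    moreover have "sl2_character M (\<lambda>m. c * k m)"
      unfolding characters by blast
    ultimately show "S \<in> gl2_graph M ` Collect (sl2_character M)" by simp
  qed
  moreover have "inj ?g"
  proof (rule injI)
    fix c d
    assume "?g c = ?g d"
    moreover have "gl2_vec m c \<in> ?g c"
      by (simp add: gl2_vec_in_graph_iff m)
    ultimately show "c = d"
      by (simp add: gl2_vec_in_graph_iff m)
  qed
  ultimately show ?thesis
    by (simp add: card_image)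
qed

lemma card_gl2_graphs_plane:
  assumes "(2 :: 'a::{field,finite}) \<noteq> 0"
  shows "card (gl2_graph (sl2_plane b) ` Collect (sl2_character (sl2_plane (b :: 'a)))) = CARD('a)"
  by (rule card_gl2_graphs[OF sl2_character_plane_iff[OF assms], of "sl2_vec (- 2 * b) 0 1"])
    (simp_all add: sl2_plane_def)

lemma card_gl2_graphs_plane_infinity:
  assumes "(2 :: 'a::{field,finite}) \<noteq> 0"
  shows "card (gl2_graph sl2_plane_infinity ` Collect (sl2_character (sl2_plane_infinity :: ('a ^ _) set)))
    = CARD('a)"
  by (rule card_gl2_graphs[OF sl2_character_plane_infinity_iff[OF assms], of "sl2_vec 0 0 1"])
    (simp_all add: sl2_plane_infinity_def)

text \<open>A subalgebra containing g loses a factor q under projection, whereas one without g keeps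
  its size; hence the different cardinalities in the two summands.\<close>

lemma card_lie_subalgebras_gl2:
  "card {S. lie_subalgebra (base_change gl2 :: 'a::{field,finite} ^ _ \<Rightarrow> _) S \<and> card S = CARD('a) * n}
    = card {M. lie_subalgebra (base_change sl2 :: 'a ^ _ \<Rightarrow> _) M \<and> card M = n}
      + (\<Sum>M | lie_subalgebra (base_change sl2 :: 'a ^ _ \<Rightarrow> _) M \<and> card M = CARD('a) * n.
          card (gl2_graph M ` Collect (sl2_character M)))"
proof -
  let ?P = "\<lambda>S. lie_subalgebra (base_change gl2 :: 'a ^ _ \<Rightarrow> _) S \<and> card S = CARD('a) * n"
  have "{S. ?P S} = {S. ?P S \<and> gl2_vec 0 1 \<in> S} \<union> {S. ?P S \<and> gl2_vec 0 1 \<notin> S}"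
    by blast
  also have "card \<dots> = card {S. ?P S \<and> gl2_vec 0 1 \<in> S} + card {S. ?P S \<and> gl2_vec 0 1 \<notin> S}"
    by (intro card_Un_disjoint finite) blast
  finally show ?thesis
    unfolding conj_assoc card_central_lie_subalgebras_gl2 card_noncentral_lie_subalgebras_gl2 .
qed

text \<open>There are 1 + q + q^2 preimages of lines, and q graphs over each of the q + 1
  planes.\<close>

lemma card_lie_subalgebras_gl2_planes:
  assumes "(2 :: 'a::{field,finite}) \<noteq> 0"
  shows "card {S. lie_subalgebra (base_change gl2 :: 'a ^ _ \<Rightarrow> _) S \<and> card S = CARD('a)\<^sup>2}
    = 1 + 2 * CARD('a) + 2 * CARD('a)\<^sup>2"
proof -
  have "(\<Sum>M | lie_subalgebra (base_change sl2 :: 'a ^ _ \<Rightarrow> _) M \<and> card M = CARD('a)\<^sup>2.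
      card (gl2_graph M ` Collect (sl2_character M)))
    = (\<Sum>M | lie_subalgebra (base_change sl2 :: 'a ^ _ \<Rightarrow> _) M \<and> card M = CARD('a)\<^sup>2. CARD('a))"
    using lie_subalgebra_sl2_cases[OF assms] card_gl2_graphs_plane[OF assms]
      card_gl2_graphs_plane_infinity[OF assms] by (intro sum.cong) auto
  also have "\<dots> = (CARD('a) + 1) * CARD('a)"
    by (simp add: card_lie_subalgebras_sl2_planes[OF assms])
  finally show ?thesis
    using card_lie_subalgebras_gl2[where 'a = 'a and n = "CARD('a)"]
      card_lie_subalgebras_sl2_lines[where 'a = 'a]
    by (simp add: power2_eq_square)
qed

text \<open>These are the q + 1 preimages of planes and one graph, that of the zero character of
  sl2.\<close>

lemma card_lie_subalgebras_gl2_hyperplanes: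
  assumes "(2 :: 'a::{field,finite}) \<noteq> 0"
  shows "card {S. lie_subalgebra (base_change gl2 :: 'a ^ _ \<Rightarrow> _) S \<and> card S = CARD('a) ^ 3} = 2 + CARD('a)"
proof -
  have "Collect (sl2_character (UNIV :: ('a ^ _) set)) = {\<lambda>_. 0}"
    using sl2_character_UNIV_iff[OF assms] by blast
  then have "(\<Sum>M | lie_subalgebra (base_change sl2 :: 'a ^ _ \<Rightarrow> _) M \<and> card M = CARD('a) ^ 3.
      card (gl2_graph M ` Collect (sl2_character M))) = 1"
    using lie_subalgebras_UNIV[of "base_change sl2 :: 'a ^ _ \<Rightarrow> _"]
    by (simp add: card_sl2_basis)
  moreover have cube: "CARD('a) * CARD('a)\<^sup>2 = CARD('a) ^ 3"
    by (simp add: power2_eq_square power3_eq_cube)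
  ultimately show ?thesis
    using card_lie_subalgebras_gl2[where 'a = 'a and n = "CARD('a)\<^sup>2"]
    unfolding cube card_lie_subalgebras_sl2_planes[OF assms] by simp
qed

lemma card_lie_subalgebras_gl2_lines:
  "card {S. lie_subalgebra (base_change gl2 :: 'a::{field,finite} ^ _ \<Rightarrow> _) S \<and> card S = CARD('a)}
     = 1 + CARD('a) + CARD('a)\<^sup>2 + CARD('a) ^ 3" (is "card ?A = _")
proof -
  have "?A = {S. vec.subspace S \<and> card S = CARD('a)}"
    by (rule lie_subalgebras_lines) (simp add: gl2_eq_iff sl2_vec_eq_iff base_change_gl2_nth)
  then show ?thesis
    using card_lines[where 'a = 'a and 'b = gl2_basis]
    by (simp add: card_gl2_basis eval_nat_numeral)
qed

section \<open>Coefficients of the two zeta functions\<close>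

lemma num_subalgebras_sl2:
  assumes "(2 :: 'a::{field,finite}) \<noteq> 0"
  defines "N \<equiv> num_subalgebras (base_change sl2 :: 'a ^ _ \<Rightarrow> _)"
  shows "N 0 = 1" "N 1 = 1 + CARD('a)" "N 2 = 1 + CARD('a) + CARD('a)\<^sup>2" "N 3 = 1"
proof -
  have N: "N i = card {S. lie_subalgebra (base_change sl2 :: 'a ^ _ \<Rightarrow> _) S \<and> card S = CARD('a) ^ k}"
    if "i + k = 3" for i k
    unfolding N_def by (rule num_subalgebras_card) (simp add: that card_sl2_basis)
  show "N 0 = 1"
    using N[of 0 3] lie_subalgebras_UNIV[of "base_change sl2 :: 'a ^ _ \<Rightarrow> _"] by (simp add: card_sl2_basis)
  show "N 1 = 1 + CARD('a)"
    using N[of 1 2] card_lie_subalgebras_sl2_planes[OF assms(1)] by simp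
  show "N 2 = 1 + CARD('a) + CARD('a)\<^sup>2"
    using N[of 2 1] card_lie_subalgebras_sl2_lines[where 'a = 'a] by simp
  have "base_change sl2 0 0 = (0 :: 'a ^ _)"
    by (simp add: base_change_def)
  then show "N 3 = 1"
    using N[of 3 0] lie_subalgebras_zero[of "base_change sl2 :: 'a ^ _ \<Rightarrow> _"] by simp
qed

lemma num_subalgebras_gl2:
  assumes "(2 :: 'a::{field,finite}) \<noteq> 0"
  defines "N \<equiv> num_subalgebras (base_change gl2 :: 'a ^ _ \<Rightarrow> _)"
  shows "N 0 = 1" "N 1 = 2 + CARD('a)" "N 2 = 1 + 2 * CARD('a) + 2 * CARD('a)\<^sup>2"
    "N 3 = 1 + CARD('a) + CARD('a)\<^sup>2 + CARD('a) ^ 3" "N 4 = 1"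
proof -
  have N: "N i = card {S. lie_subalgebra (base_change gl2 :: 'a ^ _ \<Rightarrow> _) S \<and> card S = CARD('a) ^ k}"
    if "i + k = 4" for i k
    unfolding N_def by (rule num_subalgebras_card) (simp add: that card_gl2_basis)
  show "N 0 = 1"
    using N[of 0 4] lie_subalgebras_UNIV[of "base_change gl2 :: 'a ^ _ \<Rightarrow> _"] by (simp add: card_gl2_basis)
  show "N 1 = 2 + CARD('a)"
    using N[of 1 3] card_lie_subalgebras_gl2_hyperplanes[OF assms(1)] by simp
  show "N 2 = 1 + 2 * CARD('a) + 2 * CARD('a)\<^sup>2"
    using N[of 2 2] card_lie_subalgebras_gl2_planes[OF assms(1)] by simp
  show "N 3 = 1 + CARD('a) + CARD('a)\<^sup>2 + CARD('a) ^ 3"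
    using N[of 3 1] card_lie_subalgebras_gl2_lines[where 'a = 'a] by simp
  have "base_change gl2 0 0 = (0 :: 'a ^ _)"
    by (simp add: base_change_def)
  then show "N 4 = 1"
    using N[of 4 0] lie_subalgebras_zero[of "base_change gl2 :: 'a ^ _ \<Rightarrow> _"] by simp
qed

lemma two_neq_0_mod_ring:
  assumes "CARD('p::prime_card) > 2"
  shows "(2 :: 'p mod_ring) \<noteq> 0"
proof
  assume "(2 :: 'p mod_ring) = 0"
  then have "CARD('p) dvd 2"
    by (intro of_nat_0_mod_ring_dvd) simp
  with assms show False
    by (auto dest: dvd_imp_le)
qed

theorem theorem2p11:
  fixes p :: nat and s t :: complex
  assumes "prime p" and "p > 2" and "CARD('p::prime_card) = p"
    and "t = of_nat p powr (- s)"
  shows "zeta_Fp TYPE('p) gl2 s =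
           zeta_Fp TYPE('p) sl2 s + t + of_nat (p + p^2) * t^2 + of_nat (p + p^2 + p^3) * t^3 + t^4
         \<and> zeta_Fp TYPE('p) gl2 s =
           1 + of_nat (2 + p) * t + of_nat (1 + 2 * p + 2 * p^2) * t^2
             + of_nat (1 + p + p^2 + p^3) * t^3 + t^4"
proof -
  have two: "(2 :: 'p mod_ring) \<noteq> 0"
    using assms by (intro two_neq_0_mod_ring) simp
  have q: "CARD('p mod_ring) = p"
    using assms by simp
  have gl2: "zeta_Fp TYPE('p) gl2 s =
      1 + of_nat (2 + p) * t + of_nat (1 + 2 * p + 2 * p^2) * t^2 + of_nat (1 + p + p^2 + p^3) * t^3 + t^4"
    using num_subalgebras_gl2[OF two] unfolding zeta_Fp_def card_gl2_basis
    by (simp add: q assms(3) flip: assms(4)) (simp add: eval_nat_numeral)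
  have sl2: "zeta_Fp TYPE('p) sl2 s = 1 + of_nat (1 + p) * t + of_nat (1 + p + p^2) * t^2 + t^3"
    using num_subalgebras_sl2[OF two] unfolding zeta_Fp_def card_sl2_basis
    by (simp add: q assms(3) flip: assms(4)) (simp add: eval_nat_numeral)
  \<comment> \<open>The first identity is the coefficientwise difference of the two polynomials in
    \<open>t\<close>.\<close>
  show ?thesis
    unfolding gl2 sl2 by (simp add: algebra_simps)
qed

end
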